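(* Let $n\ge 1$ be an integer. Then the polynomial identity $$A_n(p,q,t,u,v,w)=\sum_{k=0}^{\lfloor (n-1)/2\rfloor} a_{n,k}(p,q)\,(tw)^k\,(u+vt)^{n-1-2k}$$ holds. Moreover, for all $0\le k\le \lfloor (n-1)/2\rfloor$, the polynomial $a_{n,k}(p,q)$ is divisible by $(p+q)^k$.
   Context: Let $\mathfrak{S}_n$ be the set of permutations $\sigma=\sigma(1)\cdots\sigma(n)$ of $[n]=\{1,\dots,n\}$. Descents: $\mathrm{des}\,\sigma=\#\{i: 1\le i<n,\ \sigma(i)>\sigma(i+1)\}$. Patterns: $(31\text{-}2)\sigma$ is the number of pairs $(i,j)$ with $2\le i<j\le n$ and $\sigma(i-1)>\sigma(j)>\sigma(i)$; $(2\text{-}13)\sigma$ is the number of pairs $(i,j)$ with $1\le i<j\le n-1$ and $\sigma(j+1)>\sigma(i)>\sigma(j)$. With the convention $\sigma(0)=\sigma(n+1)=0$, an entry $\sigma(i)$, $i\in[n]$, is a valley if $\sigma(i-1)>\sigma(i)<\sigma(i+1)$, a double ascent if $\sigma(i-1)<\sigma(i)<\sigma(i+1)$, and a double descent if $\sigma(i-1)>\sigma(i)>\sigma(i+1)$. The numbers of valleys, double ascents and double descents of $\sigma$ under this convention are denoted $\mathrm{valley}^*\sigma$, $\mathrm{da}^*\sigma$, $\mathrm{dd}^*\sigma$. Define $$A_n(p,q,t,u,v,w)=\sum_{\sigma\in\mathfrak{S}_n}p^{(2\text{-}13)\sigma}q^{(31\text{-}2)\sigma}t^{\mathrm{des}\,\sigma}u^{\mathrm{da}^*\sigma}v^{\mathrm{dd}^*\sigma}w^{\mathrm{valley}^*\sigma}.$$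 Let $\mathfrak{S}_{n,k}$ be the set of $\sigma\in\mathfrak{S}_n$ with $\mathrm{valley}^*\sigma=k$ and $\mathrm{dd}^*\sigma=0$, and define $$a_{n,k}(p,q)=\sum_{\sigma\in\mathfrak{S}_{n,k}}p^{(2\text{-}13)\sigma}q^{(31\text{-}2)\sigma}.$$ Divisibility is in the ring $\mathbb{Z}[p,q]$. *)

theory Defs
  imports "HOL-Combinatorics.Permutations" "HOL-Library.Poly_Mapping"
begin

text \<open>
  Integer polynomials in the set of variables \<open>'x\<close>: a monomial is its finitely supported
  exponent map \<open>'x \<Rightarrow>\<^sub>0 nat\<close>, and a polynomial is a finitely supported map from monomials to
  integer coefficients, with the convolution product of \<^theory>\<open>HOL-Library.Poly_Mapping\<close>.
\<close>

type_synonym 'x int_mpoly = "('x \<Rightarrow>\<^sub>0 nat) \<Rightarrow>\<^sub>0 int"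

definition Var :: "'x \<Rightarrow> 'x int_mpoly" where
  "Var x = Poly_Mapping.single (Poly_Mapping.single x 1) 1"

text \<open>
  Two index types, so that \<open>var6 int_mpoly\<close> is \<open>\<int>[p,q,t,u,v,w]\<close> and \<open>var2 int_mpoly\<close> is
  \<open>\<int>[p,q]\<close>; divisibility in the latter allows no quotients involving further variables.
\<close>

datatype var6 = P6 | Q6 | T6 | U6 | V6 | W6

datatype var2 = P2 | Q2

text \<open>
  A permutation of \<open>{1..n}\<close> is a function \<open>\<sigma>\<close> on the naturals with \<open>\<sigma> permutes {1..n}\<close>; such a
  function is the identity outside \<open>{1..n}\<close>, so the boundary convention
  \<open>\<sigma>(0) = \<sigma>(n+1) = 0\<close> has to be imposed separately.
\<close>

definition ext0 :: "nat \<Rightarrow> (nat \<Rightarrow> nat) \<Rightarrow> nat \<Rightarrow> nat" where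
  "ext0 n \<sigma> i = (if i \<in> {1..n} then \<sigma> i else 0)"

definition des :: "nat \<Rightarrow> (nat \<Rightarrow> nat) \<Rightarrow> nat" where
  "des n \<sigma> = card {i. 1 \<le> i \<and> i < n \<and> \<sigma> i > \<sigma> (i + 1)}"

definition pat_31_2 :: "nat \<Rightarrow> (nat \<Rightarrow> nat) \<Rightarrow> nat" where
  "pat_31_2 n \<sigma> =
     card {(i, j). 2 \<le> i \<and> i < j \<and> j \<le> n \<and> \<sigma> (i - 1) > \<sigma> j \<and> \<sigma> j > \<sigma> i}"

definition pat_2_13 :: "nat \<Rightarrow> (nat \<Rightarrow> nat) \<Rightarrow> nat" where
  "pat_2_13 n \<sigma> =
     card {(i, j). 1 \<le> i \<and> i < j \<and> j \<le> n - 1 \<and> \<sigma> (j + 1) > \<sigma> i \<and> \<sigma> i > \<sigma> j}"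

definition valley :: "nat \<Rightarrow> (nat \<Rightarrow> nat) \<Rightarrow> nat" where
  "valley n \<sigma> = card {i \<in> {1..n}.
     ext0 n \<sigma> (i - 1) > ext0 n \<sigma> i \<and> ext0 n \<sigma> i < ext0 n \<sigma> (i + 1)}"

definition double_ascents :: "nat \<Rightarrow> (nat \<Rightarrow> nat) \<Rightarrow> nat" where
  "double_ascents n \<sigma> = card {i \<in> {1..n}.
     ext0 n \<sigma> (i - 1) < ext0 n \<sigma> i \<and> ext0 n \<sigma> i < ext0 n \<sigma> (i + 1)}"

definition double_descents :: "nat \<Rightarrow> (nat \<Rightarrow> nat) \<Rightarrow> nat" where
  "double_descents n \<sigma> = card {i \<in> {1..n}.
     ext0 n \<sigma> (i - 1) > ext0 n \<sigma> i \<and> ext0 n \<sigma> i > ext0 n \<sigma> (i + 1)}"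

text \<open>
  The sums below take their arguments in any commutative ring, so that \<open>a_poly n k\<close> can be
  read both in \<open>\<int>[p,q]\<close> and inside \<open>\<int>[p,q,t,u,v,w]\<close>.
\<close>

definition A_poly :: "nat \<Rightarrow> 'a::comm_ring_1 \<Rightarrow> 'a \<Rightarrow> 'a \<Rightarrow> 'a \<Rightarrow> 'a \<Rightarrow> 'a \<Rightarrow> 'a" where
  "A_poly n p q t u v w = (\<Sum>\<sigma> | \<sigma> permutes {1..n}.
     p ^ pat_2_13 n \<sigma> * q ^ pat_31_2 n \<sigma> * t ^ des n \<sigma> *
     u ^ double_ascents n \<sigma> * v ^ double_descents n \<sigma> * w ^ valley n \<sigma>)"

definition S_set :: "nat \<Rightarrow> nat \<Rightarrow> (nat \<Rightarrow> nat) set" where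
  "S_set n k = {\<sigma>. \<sigma> permutes {1..n} \<and> valley n \<sigma> = k \<and> double_descents n \<sigma> = 0}"

definition a_poly :: "nat \<Rightarrow> nat \<Rightarrow> 'a::comm_ring_1 \<Rightarrow> 'a \<Rightarrow> 'a" where
  "a_poly n k p q = (\<Sum>\<sigma> \<in> S_set n k. p ^ pat_2_13 n \<sigma> * q ^ pat_31_2 n \<sigma>)"

end

theory Submission
  imports Defs "HOL-Computational_Algebra.Polynomial"
begin

text \<open>
  Insert the values \<open>n, n - 1, \<dots>, 1\<close> in this order. Contracting every maximal factor of letters
  \<open>\<le> m\<close> of \<open>0 \<sigma>(1) \<dots> \<sigma>(n) 0\<close> to a single \<open>0\<close> gives a word whose zeros stand for the blocks that
  are not yet resolved. The letter \<open>m\<close> enters by replacing a zero with \<open>m\<close> (valley), \<open>0 m\<close> (double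
  ascent), \<open>m 0\<close> (double descent) or \<open>0 m 0\<close> (peak). If the resulting word has \<open>g + 1\<close> zeros before
  \<open>m\<close> and \<open>z - 1 - g\<close> after it, then the letter \<open>m\<close> plays the role of 2 in exactly \<open>g\<close> occurrences
  of 31-2 and in exactly \<open>z - 2 - g\<close> occurrences of 2-13. Summing over \<open>g\<close> gives the factor
  \<open>[z - 1]\<^sub>p\<^sub>,\<^sub>q\<close>, whatever the type of the letter, so that \<open>A\<^sub>n\<close> is a sum over weighted Motzkin paths
  that depends on \<open>t, u, v, w\<close> only through \<open>tw\<close> and \<open>u + vt\<close>. Setting \<open>t = u = 1\<close> and \<open>v = 0\<close>
  identifies the coefficients as the \<open>a\<^sub>n\<^sub>,\<^sub>k\<close>. A matched pair of an up and a down step carries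
  \<open>[z - 1]\<^sub>p\<^sub>,\<^sub>q [z]\<^sub>p\<^sub>,\<^sub>q\<close>, one factor of which has even index and is divisible by \<open>p + q\<close>.
\<close>

section \<open>Words with unresolved blocks and their weights\<close>

text \<open>A zero can act only as the 1, and then stands for the descent into an unresolved block.
  The outer zeros of a word thus contribute nothing.\<close>

fun word_31_2 :: "nat list \<Rightarrow> nat" where
  "word_31_2 (a # b # ys) = length (filter (\<lambda>c. b < c \<and> c < a) ys) + word_31_2 (b # ys)"
| "word_31_2 _ = 0"

text \<open>Valleys, double ascents and double descents are marked by \<open>x\<close>,
  \<open>y\<close> and \<open>y'\<close>. Peaks are not recorded, and zeros are not letters.\<close>

definition letter_weight :: "'a::comm_ring_1 \<Rightarrow> 'a \<Rightarrow> 'a \<Rightarrow> nat \<Rightarrow> nat \<Rightarrow> nat \<Rightarrow> 'a" where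
  "letter_weight x y y' a b c =
     (if b = 0 then 1 else if a < b then (if b < c then y else 1) else if b < c then x else y')"

fun local_weight :: "'a::comm_ring_1 \<Rightarrow> 'a \<Rightarrow> 'a \<Rightarrow> nat list \<Rightarrow> 'a" where
  "local_weight x y y' (a # b # c # ws) =
     letter_weight x y y' a b c * local_weight x y y' (b # c # ws)"
| "local_weight x y y' _ = 1"

text \<open>Reversal turns 2-13 into 31-2, so a single statistic serves both exponents.\<close>

definition word_weight ::
  "'a::comm_ring_1 \<Rightarrow> 'a \<Rightarrow> 'a \<Rightarrow> 'a \<Rightarrow> 'a \<Rightarrow> nat list \<Rightarrow> 'a" where
  "word_weight p q x y y' w = p ^ word_31_2 (rev w) * q ^ word_31_2 w * local_weight x y y' w"

text \<open>Letters of \<open>S\<close> occur once, so \<open>distinct_adj\<close> only forbids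
  adjacent zeros: the contracted blocks are maximal.\<close>

definition words :: "nat set \<Rightarrow> nat \<Rightarrow> nat list set" where
  "words S z = {w. w \<noteq> [] \<and> hd w = 0 \<and> last w = 0 \<and> distinct_adj w \<and>
     (\<forall>y. count_list w y = (if y = 0 then z else of_bool (y \<in> S)))}"

text \<open>The flags tell whether smaller letters of the block remain before and after
  \<open>x\<close>.\<close>

definition expand :: "bool \<Rightarrow> bool \<Rightarrow> nat \<Rightarrow> nat list" where
  "expand e f x = (if e then [0] else []) @ [x] @ (if f then [0] else [])"

definition expand_weight :: "'a::comm_ring_1 \<Rightarrow> 'a \<Rightarrow> 'a \<Rightarrow> bool \<Rightarrow> bool \<Rightarrow> 'a" where
  "expand_weight x y y' e f = (if e then if f then 1 else y else if f then y' else x)"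

section \<open>Effect on the weights of inserting a new smallest letter\<close>

lemma rev_expand: "rev (expand e f x) = expand f e x"
  by (simp add: expand_def)

lemma word_31_2_Cons_smaller:
  assumes "\<And>c. c \<in> set ys \<Longrightarrow> c = 0 \<or> m < c" "ys \<noteq> []" "hd ys \<noteq> 0"
  shows "word_31_2 (m # ys) = word_31_2 (0 # ys)"
proof (cases ys)
  case (Cons a as)
  then have "m < a" using assms by force
  then show ?thesis using Cons by (auto simp: filter_empty_conv)
qed (use assms in simp)

text \<open>All other nonzero letters exceed \<open>m\<close>, so old occurrences survive and the
  new ones have \<open>m\<close> as the 2. They correspond to the zeros before \<open>m\<close> that
  have a predecessor: those in \<open>tl xs\<close>, and the zero created by \<open>e\<close> if
  \<open>xs\<close> is nonempty.\<close>

lemma word_31_2_expand: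
  assumes "distinct_adj (xs @ 0 # ys)" "0 < m"
    and "\<And>c. c \<in> set (xs @ ys) \<Longrightarrow> c = 0 \<or> m < c" and "f \<or> ys \<noteq> []"
  shows "word_31_2 (xs @ expand e f m @ ys) =
    word_31_2 (xs @ 0 # ys) + count_list (tl xs) 0 + of_bool (xs \<noteq> [] \<and> e)"
  using assms
proof (induction xs rule: induct_list012)
  case 1
  have "filter (\<lambda>c. 0 < c \<and> c < m) ys = []"
    using 1(3) by (fastforce simp: filter_empty_conv)
  moreover have "word_31_2 (m # ys) = word_31_2 (0 # ys)" if "ys \<noteq> []"
    using 1 that by (intro word_31_2_Cons_smaller) (auto simp: distinct_adj_Cons)
  ultimately show ?case
    using 1(4) by (auto simp: expand_def)
next
  case (2 a)
  have a: "m < a" using 2 by (auto simp: distinct_adj_def)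
  have f1: "filter (\<lambda>c. m < c \<and> c < a) ys = filter (\<lambda>c. 0 < c \<and> c < a) ys"
    using 2 by (intro filter_cong) auto
  have f2: "filter (\<lambda>c. 0 < c \<and> c < m) ys = []"
    using 2 by (fastforce simp: filter_empty_conv)
  have f3: "word_31_2 (m # ys) = word_31_2 (0 # ys)" if "ys \<noteq> []"
    using 2 that by (intro word_31_2_Cons_smaller) (auto simp: distinct_adj_Cons)
  show ?case
    using 2(2,4) a f1 f2 f3 by (auto simp: expand_def)
next
  case (3 a b zs)
  \<comment> \<open>If \<open>b = 0\<close>, then \<open>a\<close> is nonzero, hence above
    \<open>m\<close>, and \<open>m\<close> is counted; if \<open>b\<close> is nonzero, it exceeds
    \<open>m\<close>.\<close>
  have "length (filter (\<lambda>c. b < c \<and> c < a) (zs @ expand e f m @ ys)) =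
        length (filter (\<lambda>c. b < c \<and> c < a) (zs @ 0 # ys)) + of_bool (b = 0)"
    using 3(3,4) 3(5)[of a] 3(5)[of b] by (auto simp: expand_def)
  moreover have "word_31_2 ((b # zs) @ expand e f m @ ys) =
      word_31_2 ((b # zs) @ 0 # ys) + count_list zs 0 + of_bool e"
    using 3 by (subst 3) auto
  ultimately show ?case by auto
qed

lemma local_weight_Cons_smaller:
  assumes "m < a" "0 < a"
  shows "local_weight x y y' (m # a # as) = local_weight x y y' (0 # a # as)"
  using assms by (cases as) (auto simp: letter_weight_def)

lemma local_weight_Cons2:
  assumes "as \<noteq> []"
  shows "local_weight x y y' (a # b # as) =
    letter_weight x y y' a b (hd as) * local_weight x y y' (b # as)"
  using assms by (cases as) auto

text \<open>The old letters compare with \<open>m\<close> as with \<open>0\<close>, so they keep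
  their types; only the factor of \<open>m\<close> is new. The last two assumptions give
  \<open>m\<close> a neighbour on both sides.\<close>

lemma local_weight_expand:
  assumes "distinct_adj (xs @ 0 # ys)" "0 < m"
    and "\<And>c. c \<in> set (xs @ ys) \<Longrightarrow> c = 0 \<or> m < c" and "f \<or> ys \<noteq> []" and "e \<or> xs \<noteq> []"
  shows "local_weight x y y' (xs @ expand e f m @ ys) =
    expand_weight x y y' e f * local_weight x y y' (xs @ 0 # ys)"
  using assms
proof (induction xs rule: induct_list012)
  case 1
  then have e: e by simp
  show ?case
  proof (cases ys)
    case Nil
    then show ?thesis using 1 e
      by (simp add: expand_def expand_weight_def letter_weight_def)
  next
    case (Cons b bs)
    have b: "m < b" using 1(1) 1(3)[of b] Cons by auto
    show ?thesis using 1(2) e b local_weight_Cons_smaller[OF b, of x y y' bs]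
      by (cases f) (auto simp: Cons expand_def expand_weight_def letter_weight_def)
  qed
next
  case (2 a)
  have a: "m < a" using 2(1) 2(3)[of a] by auto
  show ?case
  proof (cases ys)
    case Nil
    then show ?thesis using 2(2,4) a
      by (auto simp: expand_def expand_weight_def letter_weight_def)
  next
    case (Cons b bs)
    have b: "m < b" using 2(1) 2(3)[of b] Cons by auto
    show ?thesis using 2(2) a b local_weight_Cons_smaller[OF b, of x y y' bs]
      by (cases f; cases e) (auto simp: Cons expand_def expand_weight_def letter_weight_def)
  qed
next
  case (3 a b zs)
  have IH: "local_weight x y y' ((b # zs) @ expand e f m @ ys) =
      expand_weight x y y' e f * local_weight x y y' ((b # zs) @ 0 # ys)"
    using 3 by (intro 3) auto
  \<comment> \<open>The right neighbour of \<open>b\<close> changes at most from \<open>0\<close> to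
    \<open>m\<close>, and a nonzero \<open>b\<close> exceeds both.\<close>
  have "letter_weight x y y' a b (hd (zs @ expand e f m @ ys)) =
      letter_weight x y y' a b (hd (zs @ 0 # ys))"
    using 3(3) 3(5)[of b] by (cases zs) (auto simp: letter_weight_def expand_def)
  then show ?case
    using IH local_weight_Cons2[of "zs @ expand e f m @ ys" x y y' a b]
      local_weight_Cons2[of "zs @ 0 # ys" x y y' a b]
    by (simp add: expand_def mult_ac del: local_weight.simps)
qed

lemma words_count:
  "w \<in> words S z \<Longrightarrow> count_list w y = (if y = 0 then z else of_bool (y \<in> S))"
  by (simp add: words_def)

lemma words_set: "w \<in> words S z \<Longrightarrow> set w \<subseteq> insert 0 S"
  using count_list_0_iff[of w] by (fastforce simp: words_def of_bool_def split: if_splits)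

lemma finite_words:
  assumes "finite S"
  shows "finite (words S z)"
proof -
  have "words S z \<subseteq> {w. set w \<subseteq> insert 0 S \<and> length w = 
     (\<Sum>y\<in>insert 0 S. if y = 0 then z else of_bool (y \<in> S))}"
  proof
    fix w assume w: "w \<in> words S z"
    have "length w = sum (count_list w) (insert 0 S)"
      using words_set[OF w] assms by (simp add: sum_count_set)
    also have "\<dots> = (\<Sum>y\<in>insert 0 S. if y = 0 then z else of_bool (y \<in> S))"
      using words_count[OF w] by (intro sum.cong) auto
    finally show "w \<in> {w. set w \<subseteq> insert 0 S \<and> length w = 
     (\<Sum>y\<in>insert 0 S. if y = 0 then z else of_bool (y \<in> S))}" using words_set[OF w] by simp
  qed
  then show ?thesis
    using finite_lists_length_eq[of "insert 0 S"] assms by (auto intro: finite_subset)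
qed

text \<open>The exponents are the numbers of zeros after and before \<open>m\<close>, each less one:
  the outermost zero on either side belongs to no descent into, or ascent out of, a block.\<close>

lemma word_weight_expand:
  assumes w: "xs @ 0 # ys \<in> words S z" and m: "0 < m" "\<And>c. c \<in> S \<Longrightarrow> m < c"
    and ef: "e \<or> xs \<noteq> []" "f \<or> ys \<noteq> []"
  shows "word_weight p q x y y' (xs @ expand e f m @ ys) =
    p ^ (count_list ys 0 + of_bool f - 1) * q ^ (count_list xs 0 + of_bool e - 1) *
    expand_weight x y y' e f * word_weight p q x y y' (xs @ 0 # ys)"
proof -
  have adj: "distinct_adj (xs @ 0 # ys)" using w by (simp add: words_def)
  have adj': "distinct_adj (rev ys @ 0 # rev xs)"
    using adj distinct_adj_rev[of "xs @ 0 # ys"] by simp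
  have big: "c = 0 \<or> m < c" if "c \<in> set (xs @ ys)" for c
    using that words_set[OF w] m(2)[of c] by auto
  have big': "c = 0 \<or> m < c" if "c \<in> set (rev ys @ rev xs)" for c
    using that big[of c] by auto
  \<comment> \<open>A nonempty \<open>xs\<close> starts with the leading zero, which
    \<open>tl\<close> removes; for empty \<open>xs\<close> the flag \<open>e\<close> holds and both
    sides are 0.\<close>
  have xs: "count_list (tl xs) 0 + of_bool (xs \<noteq> [] \<and> e) = count_list xs 0 + of_bool e - 1"
    using w ef by (cases xs) (auto simp: words_def)
  have "count_list (tl (rev ys)) 0 + of_bool (ys \<noteq> [] \<and> f) = count_list (rev ys) 0 + of_bool f - 1"
    using w ef by (cases ys rule: rev_cases) (auto simp: words_def)
  then have ys: "count_list (tl (rev ys)) 0 + of_bool (ys \<noteq> [] \<and> f) =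
      count_list ys 0 + of_bool f - 1"
    by simp
  have "word_31_2 (xs @ expand e f m @ ys) = word_31_2 (xs @ 0 # ys) + (count_list xs 0 + of_bool e - 1)"
    using word_31_2_expand[OF adj m(1) big ef(2), of e] xs by simp
  \<comment> \<open>The same lemma for the reversed word, with the roles of \<open>xs\<close>,
    \<open>e\<close> and \<open>ys\<close>, \<open>f\<close> exchanged.\<close>
  moreover have "word_31_2 (rev ys @ expand f e m @ rev xs) =
      word_31_2 (rev ys @ 0 # rev xs) + (count_list ys 0 + of_bool f - 1)"
    using word_31_2_expand[OF adj' m(1) big', of e f] ef(1) ys by simp
  moreover have "local_weight x y y' (xs @ expand e f m @ ys) =
      expand_weight x y y' e f * local_weight x y y' (xs @ 0 # ys)"
    using local_weight_expand[OF adj m(1) big ef(2,1)] by simp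
  ultimately show ?thesis
    by (simp add: word_weight_def power_add mult_ac rev_expand)
qed

section \<open>The insertion bijection\<close>

text \<open>Words with a marked zero, the one preceded by exactly \<open>a\<close> zeros. For fixed
  \<open>a\<close> and \<open>b\<close> the mark involves no choice, so these pairs biject with the
  words themselves.\<close>

definition zero_splits :: "nat set \<Rightarrow> nat \<Rightarrow> nat \<Rightarrow> (nat list \<times> nat list) set" where
  "zero_splits S a b = {(xs, ys). xs @ 0 # ys \<in> words S (a + b + 1) \<and>
     count_list xs 0 = a \<and> count_list ys 0 = b}"

lemma split_at_nth_occurrence:
  "count_list w x > a \<Longrightarrow> \<exists>xs ys. w = xs @ x # ys \<and> count_list xs x = a"
proof (induction w arbitrary: a)
  case (Cons c w)
  show ?case
  proof (cases "c = x \<and> a = 0")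
    case True
    then show ?thesis by (intro exI[of _ "[]"] exI[of _ w]) simp
  next
    case False
    then have "a - of_bool (c = x) < count_list w x"
      using Cons.prems by (auto split: if_splits)
    then obtain xs ys where "w = xs @ x # ys" "count_list xs x = a - of_bool (c = x)"
      using Cons.IH by blast
    then show ?thesis using False
      by (intro exI[of _ "c # xs"] exI[of _ ys]) auto
  qed
qed simp

lemma split_at_occurrence_unique:
  "xs @ x # ys = xs' @ x # ys' \<Longrightarrow> count_list xs x = count_list xs' x \<Longrightarrow> xs = xs' \<and> ys = ys'"
proof (induction xs arbitrary: xs')
  case Nil
  then show ?case by (cases xs') (auto split: if_splits)
next
  case (Cons c xs)
  then show ?case by (cases xs') (auto split: if_splits)
qed

lemma bij_betw_zero_splits:
  "bij_betw (\<lambda>(xs, ys). xs @ 0 # ys) (zero_splits S a b) (words S (a + b + 1))"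
  unfolding bij_betw_def
proof
  show "inj_on (\<lambda>(xs, ys). xs @ 0 # ys) (zero_splits S a b)"
    by (auto simp: inj_on_def zero_splits_def dest: split_at_occurrence_unique)
  show "(\<lambda>(xs, ys). xs @ 0 # ys) ` zero_splits S a b = words S (a + b + 1)"
  proof (intro equalityI subsetI)
    fix w assume w: "w \<in> words S (a + b + 1)"
    then have "count_list w 0 = a + b + 1" by (simp add: words_count)
    moreover from this obtain xs ys where "w = xs @ 0 # ys" "count_list xs 0 = a"
      using split_at_nth_occurrence[of a w 0] by auto
    ultimately have "(xs, ys) \<in> zero_splits S a b"
      using w by (simp add: zero_splits_def)
    then show "w \<in> (\<lambda>(xs, ys). xs @ 0 # ys) ` zero_splits S a b"
      using \<open>w = xs @ 0 # ys\<close> by force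
  qed (auto simp: zero_splits_def)
qed

lemma expand_in_words:
  assumes "(xs, ys) \<in> zero_splits S a b" "m \<notin> S" "0 < m" "e \<or> 0 < a" "f \<or> 0 < b"
  shows "xs @ expand e f m @ ys \<in> words (insert m S) (a + b + of_bool e + of_bool f)"
proof -
  define w where "w = xs @ 0 # ys"
  have w: "w \<in> words S (a + b + 1)" and ab: "count_list xs 0 = a" "count_list ys 0 = b"
    using assms(1) by (auto simp: zero_splits_def w_def)
  have count: "count_list w c = (if c = 0 then a + b + 1 else of_bool (c \<in> S))" for c
    using words_count[OF w] .
  then have "m \<notin> set w"
    using assms(2,3) by (metis (full_types) count_list_0_iff of_bool_eq(1) less_not_refl)
  then have m: "m \<notin> set xs" "m \<notin> set ys" by (auto simp: w_def)
  have adj: "distinct_adj (xs @ 0 # ys)" and hd: "hd (xs @ 0 # ys) = 0" 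
    and last: "last (xs @ 0 # ys) = 0"
    using w by (auto simp: words_def w_def)
  have "xs \<noteq> []" if "\<not> e" using assms(4) ab that by auto
  moreover have "ys \<noteq> []" if "\<not> f" using assms(5) ab that by auto
  moreover have "distinct_adj (xs @ expand e f m @ ys)"
    using adj m \<open>0 < m\<close>
    by (auto simp: distinct_adj_append_iff distinct_adj_Cons expand_def dest: hd_in_set last_in_set)
  moreover have "count_list (xs @ expand e f m @ ys) c =
     (if c = 0 then a + b + of_bool e + of_bool f else of_bool (c \<in> insert m S))" for c
    using count[of c] count[of m] assms(2,3) ab by (auto simp: expand_def w_def)
  ultimately show ?thesis
    unfolding words_def using hd last
    by (auto simp: expand_def hd_append last_append split: if_splits)
qed

text \<open>The position of \<open>m\<close> among the zeros gives \<open>g\<close>, and the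
  neighbours of \<open>m\<close> give \<open>e\<close> and \<open>f\<close>. Undoing the expansion
  restores the marked zero. Zeros made by the flags are not in \<open>xs\<close> or
  \<open>ys\<close>, hence the subtractions.\<close>

lemma bij_betw_expand:
  assumes m: "m \<notin> S" "0 < m"
  shows "bij_betw (\<lambda>((g, e, f), (xs, ys)). xs @ expand e f m @ ys)
    (SIGMA (g, e, f) : {..<z - 1} \<times> UNIV \<times> UNIV.
       zero_splits S (g + 1 - of_bool e) (z - 1 - g - of_bool f))
    (words (insert m S) z)" (is "bij_betw ?h ?D _")
  unfolding bij_betw_def
proof
  have in_D: "m \<notin> set xs \<and> m \<notin> set ys \<and> distinct_adj (xs @ 0 # ys) \<and>
      (e \<or> xs \<noteq> []) \<and> (f \<or> ys \<noteq> []) \<and> count_list xs 0 = g + 1 - of_bool e"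
    if "((g, e, f), (xs, ys)) \<in> ?D" for g e f xs ys
  proof -
    have w: "xs @ 0 # ys \<in> words S (g + 1 - of_bool e + (z - 1 - g - of_bool f) + 1)"
      and c: "count_list xs 0 = g + 1 - of_bool e" "count_list ys 0 = z - 1 - g - of_bool f" "g < z - 1"
      using that by (auto simp: zero_splits_def)
    have "m \<notin> set (xs @ 0 # ys)" using words_set[OF w] m by auto
    moreover have "distinct_adj (xs @ 0 # ys)" using w by (simp add: words_def)
    ultimately show ?thesis using c by auto
  qed
  show "inj_on ?h ?D"
  proof (rule inj_onI)
    fix s s' assume D: "s \<in> ?D" "s' \<in> ?D" and eq: "?h s = ?h s'"
    obtain g e f xs ys where s: "s = ((g, e, f), (xs, ys))" by (metis prod.exhaust)
    obtain g' e' f' xs' ys' where s': "s' = ((g', e', f'), (xs', ys'))" by (metis prod.exhaust)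
    note A = in_D[OF D(1)[unfolded s]] and A' = in_D[OF D(2)[unfolded s']]
    have "(xs @ (if e then [0] else [])) @ m # ((if f then [0] else []) @ ys) =
        (xs' @ (if e' then [0] else [])) @ m # ((if f' then [0] else []) @ ys')"
      using eq by (simp add: s s' expand_def)
    then have "xs @ (if e then [0] else []) = xs' @ (if e' then [0] else []) \<and>
        (if f then [0] else []) @ ys = (if f' then [0] else []) @ ys'"
      using A A' m(2) by (intro split_at_occurrence_unique) auto
    then have l: "xs @ (if e then [0] else []) = xs' @ (if e' then [0] else [])"
      and r: "(if f then [0] else []) @ ys = (if f' then [0] else []) @ ys'" by auto
    \<comment> \<open>A zero at the end of \<open>xs\<close> would be adjacent to the marked zero,
      so a zero directly before \<open>m\<close> can only come from the flag.\<close>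
    have "(last (xs @ (if e then [0] else [])) = 0) = e"
      using A by (auto simp: distinct_adj_append_iff)
    moreover have "(last (xs' @ (if e' then [0] else [])) = 0) = e'"
      using A' by (auto simp: distinct_adj_append_iff)
    ultimately have e: "e = e'" using l by simp
    have "(hd ((if f then [0] else []) @ ys) = 0) = f"
      using A by (auto simp: distinct_adj_append_iff distinct_adj_Cons)
    moreover have "(hd ((if f' then [0] else []) @ ys') = 0) = f'"
      using A' by (auto simp: distinct_adj_append_iff distinct_adj_Cons)
    ultimately have f: "f = f'" using r by simp
    have "xs = xs'" "ys = ys'" using l r e f by (auto split: if_splits)
    moreover from this have "g = g'" using A A' e by (auto simp: of_bool_def split: if_splits)
    ultimately show "s = s'" using e f s s' by simp
  qed
  show "?h ` ?D = words (insert m S) z"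
  proof (intro equalityI subsetI)
    fix w assume "w \<in> ?h ` ?D"
    then obtain s where sD: "s \<in> ?D" and ws: "w = ?h s" by blast
    obtain g e f xs ys where s_eq: "s = ((g, e, f), (xs, ys))" by (metis prod.exhaust)
    have s: "((g, e, f), (xs, ys)) \<in> ?D" using sD unfolding s_eq .
    have w: "w = xs @ expand e f m @ ys" using ws by (simp add: s_eq)
    from s have "(xs, ys) \<in> zero_splits S (g + 1 - of_bool e) (z - 1 - g - of_bool f)" by simp
    moreover have g: "g < z - 1" using s by simp
    ultimately have "w \<in> words (insert m S)
        (g + 1 - of_bool e + (z - 1 - g - of_bool f) + of_bool e + of_bool f)"
      unfolding w using m by (intro expand_in_words) auto
    \<comment> \<open>Because \<open>g < z - 1\<close>, no subtraction truncates.\<close>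
    also have "g + 1 - of_bool e + (z - 1 - g - of_bool f) + of_bool e + of_bool f = z"
      using g by auto
    finally show "w \<in> words (insert m S) z" .
  next
    fix w assume w: "w \<in> words (insert m S) z"
    then have count: "count_list w c = (if c = 0 then z else of_bool (c \<in> insert m S))" for c
      by (rule words_count)
    have adj: "distinct_adj w" and w0: "hd w = 0" "last w = 0" using w by (auto simp: words_def)
    have "m \<in> set w" using count[of m] m count_list_0_iff[of w m] by auto
    then obtain l r where w_eq: "w = l @ m # r" by (meson split_list)
    have l: "l \<noteq> []" "hd l = 0" and r: "r \<noteq> []" "last r = 0"
      using w0 m(2) by (auto simp: w_eq hd_append split: if_splits)
    have mlr: "m \<notin> set l" "m \<notin> set r"
      using count[of m] m(2) by (auto simp: w_eq count_list_0_iff)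
    \<comment> \<open>A zero next to \<open>m\<close> is what remains of the block into which
      \<open>m\<close> was inserted, and is removed again.\<close>
    define e f where "e \<longleftrightarrow> last l = 0" and "f \<longleftrightarrow> hd r = 0"
    define xs ys where "xs = (if e then butlast l else l)" and "ys = (if f then tl r else r)"
    have l_eq: "l = xs @ (if e then [0] else [])"
      using append_butlast_last_id[OF l(1)]
      by (cases e) (simp_all add: xs_def e_def del: append_butlast_last_id)
    have r_eq: "r = (if f then [0] else []) @ ys"
      using list.collapse[OF r(1)] by (cases f) (simp_all add: ys_def f_def del: list.collapse)
    have w_eq': "w = xs @ expand e f m @ ys"
      by (simp add: w_eq l_eq r_eq expand_def)
    have "0 \<in> set l" "0 \<in> set r"
      using hd_in_set[OF l(1)] last_in_set[OF r(1)] l(2) r(2) by simp_all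
    then have "count_list l 0 > 0" "count_list r 0 > 0"
      by (metis count_list_0_iff neq0_conv)+
    then have pos: "count_list xs 0 + of_bool e > 0" "count_list ys 0 + of_bool f > 0"
      by (auto simp: l_eq r_eq split: if_splits)
    define g where "g = count_list xs 0 + of_bool e - 1"
    have z: "z = count_list xs 0 + count_list ys 0 + of_bool e + of_bool f"
      using count[of 0] m(2) by (auto simp: w_eq' expand_def)
    have g: "g < z - 1" "count_list xs 0 = g + 1 - of_bool e"
       "count_list ys 0 = z - 1 - g - of_bool f"
      using pos by (auto simp: g_def z)
    \<comment> \<open>The restored zero has no zero beside it: if a flag holds, the removed zero was
      already separated from other zeros; if not, the neighbour of \<open>m\<close> was
      nonzero.\<close>
    have "distinct_adj (xs @ 0 # ys)"
    proof -
      have lr: "distinct_adj l" "distinct_adj r"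
        using adj by (auto simp: w_eq distinct_adj_append_iff distinct_adj_Cons)
      have "xs = [] \<or> last xs \<noteq> 0"
      proof (cases e)
        case True
        then show ?thesis using lr(1) by (simp add: l_eq distinct_adj_append_iff)
      next
        case False
        then show ?thesis by (simp add: e_def xs_def)
      qed
      moreover have "ys = [] \<or> hd ys \<noteq> 0"
      proof (cases f)
        case True
        then show ?thesis using lr(2) by (auto simp: r_eq distinct_adj_Cons)
      next
        case False
        then show ?thesis by (simp add: f_def ys_def)
      qed
      moreover have "distinct_adj xs" "distinct_adj ys"
        using adj by (auto simp: w_eq' distinct_adj_append_iff)
      ultimately show ?thesis by (auto simp: distinct_adj_append_iff distinct_adj_Cons)
    qed
    moreover have "hd (xs @ 0 # ys) = 0" using l by (auto simp: l_eq hd_append split: if_splits)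
    moreover have "last (xs @ 0 # ys) = 0" using r by (auto simp: r_eq split: if_splits)
    moreover have "count_list (xs @ 0 # ys) c = 
        (if c = 0 then count_list xs 0 + count_list ys 0 + 1 else of_bool (c \<in> S))" for c
      using count[of c] m mlr by (auto simp: w_eq l_eq r_eq split: if_splits)
    ultimately have "xs @ 0 # ys \<in> words S (count_list xs 0 + count_list ys 0 + 1)"
      unfolding words_def by blast
    then have "(xs, ys) \<in> zero_splits S (count_list xs 0) (count_list ys 0)"
      by (simp add: zero_splits_def)
    then have "((g, e, f), (xs, ys)) \<in> ?D"
      unfolding g(2,3) using g(1) by simp
    then show "w \<in> ?h ` ?D" unfolding w_eq' by (rule rev_image_eqI) simp
  qed
qed

section \<open>Summation over words as weighted Motzkin paths\<close>

text \<open>The \<open>p,q\<close>-analogue of \<open>k\<close>, that is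
  \<open>(p^k - q^k) / (p - q)\<close> written without division.\<close>

definition pq_number :: "'a::comm_ring_1 \<Rightarrow> 'a \<Rightarrow> nat \<Rightarrow> 'a" where
  "pq_number p q k = (\<Sum>g<k. p ^ (k - 1 - g) * q ^ g)"

text \<open>
  Paths with \<open>n\<close> steps from \<open>z\<close> to 1; the height of a Motzkin path is \<open>z - 2\<close>, and the last step of
  the path, from 2 to 1, is the peak at the letter \<open>n\<close>. The junk value at \<open>z = 0\<close> is harmless, as
  the factor \<open>pq_number p q 0\<close> vanishes there.
\<close>

fun motzkin :: "'a::comm_ring_1 \<Rightarrow> 'a \<Rightarrow> 'a \<Rightarrow> 'a \<Rightarrow> nat \<Rightarrow> nat \<Rightarrow> 'a" where
  "motzkin p q x y 0 z = of_bool (z = 1)"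
| "motzkin p q x y (Suc n) z = pq_number p q (z - 1) *
     (x * motzkin p q x y n (z + 1) + y * motzkin p q x y n z + motzkin p q x y n (z - 1))"

text \<open>Before any insertion the whole permutation is one block; this is the end point 1 of the
  paths.\<close>

lemma words_empty: "words {} z = (if z = 1 then {[0]} else {})"
proof -
  have "w = [0] \<and> z = 1" if w: "w \<in> words {} z" for w
  proof (cases w rule: remdups_adj.cases)
    case 1
    then show ?thesis using w by (simp add: words_def)
  next
    case 2
    then show ?thesis using words_set[OF w] words_count[OF w, of 0] by simp
  next
    case 3
    moreover have "distinct_adj w" using w by (simp add: words_def)
    ultimately show ?thesis using words_set[OF w] by simp
  qed
  moreover have "[0] \<in> words {} 1" by (simp add: words_def)
  ultimately have "w \<in> words {} z \<longleftrightarrow> w = [0] \<and> z = 1" for w by blast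
  then have "words {} z = {w. w = [0] \<and> z = 1}" by blast
  then show ?thesis by simp
qed

text \<open>The induction adds a new minimum each time, so the last letter inserted is the first
  step of the path. Its type determines the step, and its position among the zeros the
  weight.\<close>

lemma sum_word_weight:
  assumes "finite S" "0 \<notin> S"
  shows "(\<Sum>w\<in>words S z. word_weight p q x y y' w) = motzkin p q x (y + y') (card S) z"
  using assms
proof (induction S arbitrary: z rule: finite_linorder_min_induct)
  case empty
  then show ?case by (simp add: words_empty word_weight_def)
next
  case (insert m S)
  let ?W = "word_weight p q x y y'" and ?M = "motzkin p q x (y + y') (card S)"
  let ?P = "\<lambda>g e f. zero_splits S (g + 1 - of_bool e) (z - 1 - g - of_bool f)"
  have m: "0 < m" "m \<notin> S" and less: "\<And>c. c \<in> S \<Longrightarrow> m < c"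
    and IH: "\<And>z. (\<Sum>w\<in>words S z. ?W w) = ?M z"
    using insert by auto
  have fin: "finite (zero_splits S a b)" for a b
    using bij_betw_finite[OF bij_betw_zero_splits] finite_words[OF insert(1)] by blast
  \<comment> \<open>With position and type fixed, the new factor is constant, and the split words
    run once through all words with \<open>z + 1 - of_bool e - of_bool f\<close> zeros.\<close>
  have inner: "(\<Sum>(xs, ys)\<in>?P g e f. ?W (xs @ expand e f m @ ys)) =
      p ^ (z - 1 - 1 - g) * q ^ g * (expand_weight x y y' e f * ?M (z + 1 - of_bool e - of_bool f))"
    if g: "g < z - 1" for g e f
  proof -
    have "(\<Sum>(xs, ys)\<in>?P g e f. ?W (xs @ expand e f m @ ys)) =
        (\<Sum>s\<in>?P g e f. p ^ (z - 1 - 1 - g) * q ^ g * expand_weight x y y' e f *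
           ?W ((\<lambda>(xs, ys). xs @ 0 # ys) s))"
    proof (intro sum.cong refl)
      fix s assume s: "s \<in> ?P g e f"
      obtain xs ys where s_eq: "s = (xs, ys)" by (rule prod.exhaust)
      have "(xs, ys) \<in> ?P g e f" using s unfolding s_eq .
      then have w: "xs @ 0 # ys \<in> words S (g + 1 - of_bool e + (z - 1 - g - of_bool f) + 1)"
        and c: "count_list xs 0 = g + 1 - of_bool e" "count_list ys 0 = z - 1 - g - of_bool f"
        by (auto simp: zero_splits_def)
      have "e \<or> xs \<noteq> []" "f \<or> ys \<noteq> []" using c g by auto
      note word_weight_expand[OF w m(1) less this]
      moreover have "count_list ys 0 + of_bool f - 1 = z - 1 - 1 - g"
        "count_list xs 0 + of_bool e - 1 = g"
        using c g by auto
      ultimately show "(case s of (xs, ys) \<Rightarrow> ?W (xs @ expand e f m @ ys)) =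
        p ^ (z - 1 - 1 - g) * q ^ g * expand_weight x y y' e f *
           ?W (case s of (xs, ys) \<Rightarrow> xs @ 0 # ys)" by (simp add: s_eq)
    qed
    also have "\<dots> = p ^ (z - 1 - 1 - g) * q ^ g * expand_weight x y y' e f *
       (\<Sum>s\<in>?P g e f. ?W ((\<lambda>(xs, ys). xs @ 0 # ys) s))"
      by (simp add: sum_distrib_left)
    also have "(\<Sum>s\<in>?P g e f. ?W ((\<lambda>(xs, ys). xs @ 0 # ys) s)) =
       ?M (g + 1 - of_bool e + (z - 1 - g - of_bool f) + 1)"
      unfolding IH[symmetric] by (rule sum.reindex_bij_betw[OF bij_betw_zero_splits])
    also have "g + 1 - of_bool e + (z - 1 - g - of_bool f) + 1 = z + 1 - of_bool e - of_bool f"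
      using g by auto
    finally show ?thesis by (simp add: mult.assoc)
  qed
  have "(\<Sum>w\<in>words (insert m S) z. ?W w) =
    (\<Sum>s\<in>(SIGMA (g, e, f) : {..<z - 1} \<times> UNIV \<times> UNIV. ?P g e f).
       ?W ((\<lambda>((g, e, f), (xs, ys)). xs @ expand e f m @ ys) s))"
    by (rule sum.reindex_bij_betw[OF bij_betw_expand[OF m(2,1)], symmetric])
  also have "\<dots> = (\<Sum>(g, e, f)\<in>{..<z - 1} \<times> UNIV \<times> UNIV. \<Sum>(xs, ys)\<in>?P g e f.
       ?W (xs @ expand e f m @ ys))"
    unfolding case_prod_unfold by (subst sum.Sigma) (simp_all add: fin case_prod_unfold)
  also have "\<dots> = (\<Sum>g<z - 1. \<Sum>e\<in>UNIV. \<Sum>f\<in>UNIV. \<Sum>(xs, ys)\<in>?P g e f.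
       ?W (xs @ expand e f m @ ys))"
    by (simp only: sum.cartesian_product case_prod_unfold)
  also have "\<dots> = (\<Sum>g<z - 1. \<Sum>e\<in>UNIV. \<Sum>f\<in>UNIV. p ^ (z - 1 - 1 - g) * q ^ g *
      (expand_weight x y y' e f * ?M (z + 1 - of_bool e - of_bool f)))"
    using inner by (intro sum.cong refl) auto
  \<comment> \<open>The powers depend only on \<open>g\<close>, the rest only on \<open>e\<close>
    and \<open>f\<close>, so the sum factors.\<close>
  also have "\<dots> = pq_number p q (z - 1) *
      (\<Sum>e\<in>UNIV. \<Sum>f\<in>UNIV. expand_weight x y y' e f * ?M (z + 1 - of_bool e - of_bool f))"
    by (simp only: pq_number_def sum_distrib_left[symmetric] sum_distrib_right[symmetric])
  also have "\<dots> = motzkin p q x (y + y') (Suc (card S)) z"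
  proof -
    \<comment> \<open>Double ascents and double descents both leave \<open>z\<close> zeros, so
      \<open>y\<close> and \<open>y'\<close> enter only through their sum.\<close>
    have "(\<Sum>e\<in>UNIV. \<Sum>f\<in>UNIV. expand_weight x y y' e f * ?M (z + 1 - of_bool e - of_bool f)) =
        x * ?M (z + 1) + (y + y') * ?M z + ?M (z - 1)"
      unfolding UNIV_bool by (simp add: expand_weight_def distrib_right)
    then show ?thesis by simp
  qed
  finally show ?case using insert(1) m by simp
qed

section \<open>Expansion by the number of up steps\<close>

text \<open>Total \<open>p,q\<close>-weight of the paths with exactly \<open>k\<close> up steps, the
  step variables \<open>x\<close> and \<open>y\<close> being stripped off.\<close>

fun motzkin_coeff :: "'a::comm_ring_1 \<Rightarrow> 'a \<Rightarrow> nat \<Rightarrow> nat \<Rightarrow> nat \<Rightarrow> 'a" where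
  "motzkin_coeff p q 0 z k = of_bool (z = 1 \<and> k = 0)"
| "motzkin_coeff p q (Suc n) z k = pq_number p q (z - 1) *
     ((if k = 0 then 0 else motzkin_coeff p q n (z + 1) (k - 1)) +
      motzkin_coeff p q n z k + motzkin_coeff p q n (z - 1) k)"

text \<open>A path from \<open>z\<close> to 1 with \<open>k\<close> up steps has
  \<open>k + (z - 1)\<close> down steps.\<close>

lemma motzkin_coeff_eq_0: "n < 2 * k + (z - 1) \<Longrightarrow> motzkin_coeff p q n z k = 0"
proof (induction n arbitrary: z k)
  case (Suc n)
  show ?case
  proof (cases "z \<le> 1")
    case True
    then show ?thesis by (simp add: pq_number_def)
  next
    case False
    then show ?thesis using Suc by auto
  qed
qed auto

text \<open>The exponent of \<open>y\<close> counts the level steps. A common bound \<open>K\<close>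
  lets the three sums of the recursion be added term by term.\<close>

lemma motzkin_eq_sum:
  "n \<le> K \<Longrightarrow> motzkin p q x y n z =
     (\<Sum>k\<le>K. motzkin_coeff p q n z k * x ^ k * y ^ (n - (z - 1) - 2 * k))"
proof (induction n arbitrary: z)
  case 0
  have "(\<Sum>k\<le>K. motzkin_coeff p q 0 z k * x ^ k * y ^ (0 - (z - 1) - 2 * k)) =
      (\<Sum>k\<le>K. if k = 0 then of_bool (z = 1) else 0)"
    by (intro sum.cong) auto
  then show ?case by simp
next
  case (Suc n)
  let ?c = "motzkin_coeff p q n"
  show ?case
  proof (cases "z \<le> 1")
    case True
    then show ?thesis by (simp add: pq_number_def)
  next
    case False
    let ?y = "\<lambda>k. y ^ (Suc n - (z - 1) - 2 * k)"
    have up: "x * motzkin p q x y n (z + 1) =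
        (\<Sum>k\<le>K. (if k = 0 then 0 else ?c (z + 1) (k - 1)) * x ^ k * ?y k)"
    proof -
      have "x * motzkin p q x y n (z + 1) = (\<Sum>k\<le>K. ?c (z + 1) k * x ^ Suc k * ?y (Suc k))"
        unfolding Suc.IH[OF Suc_leD[OF Suc.prems]] sum_distrib_left
      proof (intro sum.cong refl)
        fix k
        show "x * (?c (z + 1) k * x ^ k * y ^ (n - (z + 1 - 1) - 2 * k)) =
            ?c (z + 1) k * x ^ Suc k * ?y (Suc k)"
        \<comment> \<open>Where the exponent of \<open>y\<close> would truncate, the coefficient is
          0.\<close>
        proof (cases "n < 2 * k + z")
          case True
          then show ?thesis by (simp add: motzkin_coeff_eq_0)
        next
          case False
          then have "Suc n - (z - 1) - 2 * Suc k = n - (z + 1 - 1) - 2 * k"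
            using \<open>\<not> z \<le> 1\<close> by simp
          then show ?thesis by (simp add: mult_ac)
        qed
      qed
      \<comment> \<open>The term \<open>k = K\<close> has too many up steps for \<open>n < K\<close>
        steps and vanishes, which makes room for the index shift.\<close>
      also have "\<dots> = (\<Sum>k<K. ?c (z + 1) k * x ^ Suc k * ?y (Suc k))"
        using Suc.prems False
        by (simp add: lessThan_Suc_atMost[symmetric] motzkin_coeff_eq_0)
      also have "\<dots> = (\<Sum>k<Suc K. (if k = 0 then 0 else ?c (z + 1) (k - 1)) * x ^ k * ?y k)"
        by (simp add: sum.lessThan_Suc_shift del: sum.lessThan_Suc)
      finally show ?thesis by (simp add: lessThan_Suc_atMost)
    qed
    have level: "y * motzkin p q x y n z = (\<Sum>k\<le>K. ?c z k * x ^ k * ?y k)"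
      unfolding Suc.IH[OF Suc_leD[OF Suc.prems]] sum_distrib_left
    proof (intro sum.cong refl)
      fix k
      show "y * (?c z k * x ^ k * y ^ (n - (z - 1) - 2 * k)) = ?c z k * x ^ k * ?y k"
      proof (cases "n < 2 * k + (z - 1)")
        case True
        then show ?thesis by (simp add: motzkin_coeff_eq_0)
      next
        case False
        then have "Suc n - (z - 1) - 2 * k = Suc (n - (z - 1) - 2 * k)" by simp
        then show ?thesis by (simp add: mult_ac)
      qed
    qed
    have "n - (z - 1 - 1) = Suc n - (z - 1)" using False by simp
    then have down: "motzkin p q x y n (z - 1) = (\<Sum>k\<le>K. ?c (z - 1) k * x ^ k * ?y k)"
      using Suc.IH[OF Suc_leD[OF Suc.prems], of "z - 1"] by simp
    show ?thesis
      unfolding motzkin.simps up level down sum.distrib[symmetric] sum_distrib_left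
      by (intro sum.cong refl) (simp add: algebra_simps)
  qed
qed

section \<open>Divisibility by powers of \<open>p + q\<close>\<close>

text \<open>Splitting off the first two terms keeps the parity of the index and exhibits
  \<open>p + q\<close>.\<close>

lemma pq_number_Suc_Suc: "pq_number p q (Suc (Suc k)) = p ^ k * (p + q) + q ^ 2 * pq_number p q k"
proof -
  have "pq_number p q (Suc (Suc k)) = p ^ Suc k + p ^ k * q + (\<Sum>g<k. p ^ (k - 1 - g) * q ^ (g + 2))"
    unfolding pq_number_def sum.lessThan_Suc_shift by simp
  also have "(\<Sum>g<k. p ^ (k - 1 - g) * q ^ (g + 2)) = q ^ 2 * pq_number p q k"
    unfolding pq_number_def sum_distrib_left power_add by (simp only: mult_ac)
  finally show ?thesis by (simp add: distrib_left)
qed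

lemma dvd_pq_number: "even k \<Longrightarrow> p + q dvd pq_number p q k"
proof (induction k rule: induct_nat_012)
  case (ge2 n)
  then show ?case by (simp add: pq_number_Suc_Suc)
qed (simp_all add: pq_number_def)

text \<open>
  Besides the \<open>k\<close> up steps with their matching down steps, a path from \<open>z\<close> to 1 has unmatched down
  steps of weights \<open>[z - 1], \<dots>, [1]\<close>, of which \<open>(z - 1) div 2\<close> have an even index.
\<close>

lemma power_dvd_motzkin_coeff: "(p + q) ^ (k + (z - 1) div 2) dvd motzkin_coeff p q n z k"
proof (induction n arbitrary: z k)
  case (Suc n)
  \<comment> \<open>A step starting at \<open>z\<close> contributes a factor \<open>p + q\<close>
    when \<open>z - 1\<close> is even.\<close>
  have step: "(p + q) ^ (k + (z - 1) div 2) dvd pq_number p q (z - 1) * r"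
    if "(p + q) ^ i dvd r" "k + (z - 1) div 2 \<le> i + of_bool (even (z - 1))" for i r
  proof -
    have "(p + q) ^ (of_bool (even (z - 1)) + i) dvd pq_number p q (z - 1) * r"
      unfolding power_add using that(1) dvd_pq_number[of "z - 1" p q]
      by (intro mult_dvd_mono) auto
    then show ?thesis using that(2) by (metis add.commute power_le_dvd)
  qed
  show ?case
  proof (cases "z \<le> 1")
    case True
    then show ?thesis by (simp add: pq_number_def)
  next
    case False
    have "(p + q) ^ (k + (z - 1) div 2) dvd pq_number p q (z - 1) * motzkin_coeff p q n (z + 1) (k - 1)"
      if "k \<noteq> 0"
    proof (rule step[OF Suc])
      \<comment> \<open>For odd \<open>z\<close> the loss in \<open>k\<close> is offset by the even
        index \<open>z - 1\<close>, for even \<open>z\<close> by the growth of the floor from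
        \<open>(z - 1) div 2\<close> to \<open>z div 2\<close>.\<close>
      show "k + (z - 1) div 2 \<le> k - 1 + (z + 1 - 1) div 2 + of_bool (even (z - 1))"
        using that False unfolding of_bool_def by presburger
    qed
    moreover have "(p + q) ^ (k + (z - 1) div 2) dvd pq_number p q (z - 1) * motzkin_coeff p q n z k"
      by (intro step[OF Suc]) auto
    moreover have "(p + q) ^ (k + (z - 1) div 2) dvd pq_number p q (z - 1) * motzkin_coeff p q n (z - 1) k"
    proof (rule step[OF Suc])
      show "k + (z - 1) div 2 \<le> k + (z - 1 - 1) div 2 + of_bool (even (z - 1))"
        using False unfolding of_bool_def by presburger
    qed
    ultimately show ?thesis by (auto simp: distrib_left intro!: dvd_add)
  qed
qed auto

section \<open>Permutation statistics as word statistics\<close>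

lemma word_31_2_eq_card:
  "word_31_2 w = card {(i, j). Suc i < j \<and> j < length w \<and> w ! Suc i < w ! j \<and> w ! j < w ! i}"
proof (induction w rule: word_31_2.induct)
  case (1 a b ys)
  let ?J = "{j. j < length ys \<and> b < ys ! j \<and> ys ! j < a}"
  let ?T = "{(i, j). Suc i < j \<and> j < length (b # ys) \<and>
    (b # ys) ! Suc i < (b # ys) ! j \<and> (b # ys) ! j < (b # ys) ! i}"
  have fin: "finite ?T"
    by (rule finite_subset[of _ "{..length ys} \<times> {..length ys}"]) auto
  have "{(i, j). Suc i < j \<and> j < length (a # b # ys) \<and>
      (a # b # ys) ! Suc i < (a # b # ys) ! j \<and> (a # b # ys) ! j < (a # b # ys) ! i} =
      (\<lambda>j. (0, Suc (Suc j))) ` ?J \<union> map_prod Suc Suc ` ?T" (is "?L = ?R")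
  proof (intro equalityI subsetI)
    fix s assume s: "s \<in> ?L"
    obtain i j where s_eq: "s = (i, j)" by (cases s)
    show "s \<in> ?R"
    proof (cases i)
      case 0
      then obtain j' where "j = Suc (Suc j')"
        using s s_eq by (auto dest!: less_imp_Suc_add)
      then show ?thesis using s s_eq 0 by auto
    next
      case (Suc i')
      then obtain j' where "j = Suc j'" using s s_eq by (cases j) auto
      then show ?thesis using s s_eq Suc by auto
    qed
  qed auto
  moreover have "card ((\<lambda>j. (0::nat, Suc (Suc j))) ` ?J) = card ?J"
    by (intro card_image) (auto simp: inj_on_def)
  moreover have "card (map_prod Suc Suc ` ?T) = card ?T"
    by (intro card_image) (auto simp: inj_on_def)
  moreover have "(\<lambda>j. (0, Suc (Suc j))) ` ?J \<inter> map_prod Suc Suc ` ?T = {}"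
    by auto
  ultimately show ?case
    using 1 fin by (simp add: card_Un_disjoint length_filter_conv_card)
qed (auto simp: card_eq_0_iff)

lemma local_weight_eq_prod:
  "local_weight x y y' w =
    (\<Prod>i<length w - 2. letter_weight x y y' (w ! i) (w ! Suc i) (w ! Suc (Suc i)))"
  by (induction x y y' w rule: local_weight.induct)
     (simp_all add: prod.lessThan_Suc_shift del: prod.lessThan_Suc)

definition perm_word :: "nat \<Rightarrow> (nat \<Rightarrow> nat) \<Rightarrow> nat list" where
  "perm_word n \<sigma> = 0 # map \<sigma> [1..<Suc n] @ [0]"

lemma length_perm_word [simp]: "length (perm_word n \<sigma>) = n + 2"
  by (simp add: perm_word_def)

lemma nth_perm_word: "i \<le> Suc n \<Longrightarrow> perm_word n \<sigma> ! i = ext0 n \<sigma> i"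
  by (cases i) (auto simp: perm_word_def ext0_def nth_append simp del: upt_Suc)

lemma ext0_pos:
  assumes "\<sigma> permutes {1..n}" "i \<in> {1..n}"
  shows "0 < ext0 n \<sigma> i"
  using permutes_in_image[OF assms(1), of i] assms(2) by (simp add: ext0_def)

lemma ext0_neq:
  assumes "\<sigma> permutes {1..n}" "i \<in> {1..n}" "j \<noteq> i"
  shows "ext0 n \<sigma> i \<noteq> ext0 n \<sigma> j"
  using ext0_pos[OF assms(1,2)] inj_eq[OF permutes_inj[OF assms(1)], of i j] assms(2,3)
  by (auto simp: ext0_def)

text \<open>Position \<open>i\<close> of the word holds \<open>\<sigma> i\<close>. The pattern is
  indexed by its 1 in the permutation and by its 3 in the word, hence the shift; the boundary zeros
  are too small to act as 3 or 2.\<close>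

lemma pat_31_2_eq: "pat_31_2 n \<sigma> = word_31_2 (perm_word n \<sigma>)"
proof -
  have "bij_betw (\<lambda>(i, j). (i - 1, j))
    {(i, j). 2 \<le> i \<and> i < j \<and> j \<le> n \<and> \<sigma> (i - 1) > \<sigma> j \<and> \<sigma> j > \<sigma> i}
    {(i, j). Suc i < j \<and> j < length (perm_word n \<sigma>) \<and>
      perm_word n \<sigma> ! Suc i < perm_word n \<sigma> ! j \<and> perm_word n \<sigma> ! j < perm_word n \<sigma> ! i}"
    by (rule bij_betw_byWitness[where f' = "\<lambda>(i, j). (Suc i, j)"])
       (auto simp: nth_perm_word ext0_def split: if_splits)
  then show ?thesis
    unfolding pat_31_2_def word_31_2_eq_card by (rule bij_betw_same_card)
qed

text \<open>Reversal sends position \<open>i\<close> to \<open>Suc n - i\<close>, so the 3 at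
  \<open>j + 1\<close> lands at \<open>n - j\<close> and the 2 at \<open>Suc n - i\<close>.\<close>

lemma pat_2_13_eq: "pat_2_13 n \<sigma> = word_31_2 (rev (perm_word n \<sigma>))"
proof -
  have nth: "rev (perm_word n \<sigma>) ! i = ext0 n \<sigma> (Suc n - i)" if "i \<le> Suc n" for i
    using that by (simp add: rev_nth nth_perm_word)
  have "bij_betw (\<lambda>(i, j). (n - j, Suc n - i))
    {(i, j). 1 \<le> i \<and> i < j \<and> j \<le> n - 1 \<and> \<sigma> (j + 1) > \<sigma> i \<and> \<sigma> i > \<sigma> j}
    {(i, j). Suc i < j \<and> j < length (rev (perm_word n \<sigma>)) \<and>
      rev (perm_word n \<sigma>) ! Suc i < rev (perm_word n \<sigma>) ! j \<and>
      rev (perm_word n \<sigma>) ! j < rev (perm_word n \<sigma>) ! i}"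
    by (rule bij_betw_byWitness[where f' = "\<lambda>(i, j). (Suc n - j, n - i)"],
        auto simp: nth ext0_def Suc_diff_le split: if_splits, arith+)
  then show ?thesis
    unfolding pat_2_13_def word_31_2_eq_card by (rule bij_betw_same_card)
qed

text \<open>The bottom of a descent is a double descent or a valley. The final drop to the boundary
  zero has its bottom at \<open>n + 1\<close>, outside the range.\<close>

lemma des_eq:
  assumes "\<sigma> permutes {1..n}"
  shows "des n \<sigma> = double_descents n \<sigma> + valley n \<sigma>"
proof -
  have "des n \<sigma> = card (Suc ` {i. 1 \<le> i \<and> i < n \<and> \<sigma> i > \<sigma> (i + 1)})"
    by (simp add: des_def card_image)
  also have "Suc ` {i. 1 \<le> i \<and> i < n \<and> \<sigma> i > \<sigma> (i + 1)} =
      {i \<in> {1..n}. ext0 n \<sigma> (i - 1) > ext0 n \<sigma> i}"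
  proof (intro equalityI subsetI)
    fix i assume i: "i \<in> {i \<in> {1..n}. ext0 n \<sigma> (i - 1) > ext0 n \<sigma> i}"
    then obtain j where "i = Suc j" by (cases i) auto
    then show "i \<in> Suc ` {i. 1 \<le> i \<and> i < n \<and> \<sigma> i > \<sigma> (i + 1)}"
      using i by (auto simp: ext0_def split: if_splits)
  qed (auto simp: ext0_def)
  also have "\<dots> =
     {i \<in> {1..n}. ext0 n \<sigma> (i - 1) > ext0 n \<sigma> i \<and> ext0 n \<sigma> i > ext0 n \<sigma> (i + 1)} \<union>
     {i \<in> {1..n}. ext0 n \<sigma> (i - 1) > ext0 n \<sigma> i \<and> ext0 n \<sigma> i < ext0 n \<sigma> (i + 1)}"
    using ext0_neq[OF assms] by (auto simp: neq_iff)
  also have "card \<dots> = double_descents n \<sigma> + valley n \<sigma>"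
    unfolding double_descents_def valley_def by (intro card_Un_disjoint) auto
  finally show ?thesis .
qed

lemma prod_if_one:
  "finite A \<Longrightarrow> (\<Prod>i\<in>A. if P i then c else 1) = (c :: 'a :: comm_monoid_mult) ^ card {i \<in> A. P i}"
  by (simp flip: prod.inter_filter)

text \<open>By \<open>des_eq\<close> the power of \<open>t\<close> can be distributed over the
  letters: one \<open>t\<close> for each double descent and each valley.\<close>

lemma local_weight_perm_word:
  assumes "\<sigma> permutes {1..n}"
  shows "local_weight (t * w) u (v * t) (perm_word n \<sigma>) =
    t ^ des n \<sigma> * u ^ double_ascents n \<sigma> * v ^ double_descents n \<sigma> * w ^ valley n \<sigma>"
proof -
  let ?e = "ext0 n \<sigma>"
  have "local_weight (t * w) u (v * t) (perm_word n \<sigma>) =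
      (\<Prod>i<n. letter_weight (t * w) u (v * t) (?e i) (?e (Suc i)) (?e (Suc (Suc i))))"
    unfolding local_weight_eq_prod by (intro prod.cong) (simp_all add: nth_perm_word)
  also have "\<dots> = (\<Prod>i\<in>{1..n}. letter_weight (t * w) u (v * t) (?e (i - 1)) (?e i) (?e (i + 1)))"
    by (simp add: prod.atLeast1_atMost_eq)
  also have "\<dots> = (\<Prod>i\<in>{1..n}. (if ?e (i - 1) < ?e i \<and> ?e i < ?e (i + 1) then u else 1) *
      (if ?e (i - 1) > ?e i \<and> ?e i > ?e (i + 1) then v * t else 1) *
      (if ?e (i - 1) > ?e i \<and> ?e i < ?e (i + 1) then t * w else 1))"
  proof (intro prod.cong refl)
    fix i assume i: "i \<in> {1..n}"
    have "?e i \<noteq> ?e (i - 1)" "?e i \<noteq> ?e (i + 1)"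
      using i by (intro ext0_neq[OF assms]; force)+
    then show "letter_weight (t * w) u (v * t) (?e (i - 1)) (?e i) (?e (i + 1)) =
      (if ?e (i - 1) < ?e i \<and> ?e i < ?e (i + 1) then u else 1) *
      (if ?e (i - 1) > ?e i \<and> ?e i > ?e (i + 1) then v * t else 1) *
      (if ?e (i - 1) > ?e i \<and> ?e i < ?e (i + 1) then t * w else 1)"
      using ext0_pos[OF assms i] by (auto simp: letter_weight_def)
  qed
  also have "\<dots> = u ^ double_ascents n \<sigma> * (v * t) ^ double_descents n \<sigma> * (t * w) ^ valley n \<sigma>"
    unfolding prod.distrib double_ascents_def double_descents_def valley_def
    by (simp only: prod_if_one[OF finite_atLeastAtMost])
  also have "\<dots> = t ^ des n \<sigma> * u ^ double_ascents n \<sigma> * v ^ double_descents n \<sigma> * w ^ valley n \<sigma>"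
    unfolding des_eq[OF assms] by (simp add: power_add power_mult_distrib mult_ac)
  finally show ?thesis .
qed

lemma count_list_distinct: "distinct xs \<Longrightarrow> count_list xs y = of_bool (y \<in> set xs)"
  by (induction xs) auto

lemma distinct_if_count_list_le_1: "(\<And>y. count_list xs y \<le> 1) \<Longrightarrow> distinct xs"
proof (induction xs)
  case (Cons a xs)
  have "count_list xs y \<le> 1" for y
    using Cons.prems[of y] by (auto split: if_splits)
  moreover have "a \<notin> set xs"
    using Cons.prems[of a] by (simp add: count_list_0_iff)
  ultimately show ?case using Cons.IH by simp
qed simp

text \<open>With all letters inserted, only the two boundary zeros remain. They are not adjacent
  because \<open>n\<close> is positive.\<close>

lemma bij_betw_perm_word:
  assumes "1 \<le> n"
  shows "bij_betw (perm_word n) {\<sigma>. \<sigma> permutes {1..n}} (words {1..n} 2)"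
  unfolding bij_betw_def
proof
  show "inj_on (perm_word n) {\<sigma>. \<sigma> permutes {1..n}}"
  proof (intro inj_onI ext)
    fix \<sigma> \<tau> i assume "\<sigma> \<in> {\<sigma>. \<sigma> permutes {1..n}}" "\<tau> \<in> {\<sigma>. \<sigma> permutes {1..n}}"
      and eq: "perm_word n \<sigma> = perm_word n \<tau>"
    then have perm: "\<sigma> permutes {1..n}" "\<tau> permutes {1..n}" by auto
    show "\<sigma> i = \<tau> i"
    proof (cases "i \<in> {1..n}")
      case True
      then have "ext0 n \<sigma> i = ext0 n \<tau> i"
        using nth_perm_word[of i n \<sigma>] nth_perm_word[of i n \<tau>] eq by simp
      then show ?thesis using True by (simp add: ext0_def)
    next
      case False
      then show ?thesis using perm by (simp add: permutes_not_in)
    qed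
  qed
  show "perm_word n ` {\<sigma>. \<sigma> permutes {1..n}} = words {1..n} 2"
  proof (intro equalityI subsetI)
    fix w assume "w \<in> perm_word n ` {\<sigma>. \<sigma> permutes {1..n}}"
    then obtain \<sigma> where \<sigma>: "\<sigma> permutes {1..n}" and w: "w = perm_word n \<sigma>" by auto
    have "w ! i \<noteq> w ! Suc i" if "Suc i < length w" for i
    proof (cases "i = 0")
      case True
      then show ?thesis using assms ext0_neq[OF \<sigma>, of 1 0] by (simp add: w nth_perm_word)
    next
      case False
      then show ?thesis using that ext0_neq[OF \<sigma>, of i "Suc i"] by (simp add: w nth_perm_word)
    qed
    then have "distinct_adj w" by (simp add: distinct_adj_conv_nth)
    moreover have "count_list w y = (if y = 0 then 2 else of_bool (y \<in> {1..n}))" for y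
    proof -
      have "distinct (map \<sigma> [1..<Suc n])"
        using permutes_inj[OF \<sigma>] by (simp add: distinct_map inj_on_def inj_def del: upt_Suc)
      moreover have "set (map \<sigma> [1..<Suc n]) = {1..n}"
        using permutes_image[OF \<sigma>] by (simp add: atLeastLessThanSuc_atLeastAtMost del: upt_Suc)
      ultimately show ?thesis
        by (simp add: w perm_word_def count_list_distinct del: upt_Suc set_map)
    qed
    ultimately show "w \<in> words {1..n} 2"
      unfolding words_def by (simp add: w perm_word_def)
  next
    fix w assume w: "w \<in> words {1..n} 2"
    have hd_last: "w \<noteq> []" "hd w = 0" "last w = 0" using w by (auto simp: words_def)
    then obtain w' where w': "w = 0 # w'" by (cases w) auto
    then have "w' \<noteq> []" using words_count[OF w, of 0] by auto
    then obtain l where w_eq: "w = 0 # l @ [0]"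
      using w' hd_last(3) by (cases w' rule: rev_cases) auto
    have count: "count_list l y = of_bool (y \<in> {1..n})" for y
      using words_count[OF w, of y] by (auto simp: w_eq split: if_splits)
    have l: "distinct l" by (rule distinct_if_count_list_le_1) (simp add: count)
    have set_l: "set l = {1..n}"
      using count count_list_0_iff[of l] by (auto simp: set_eq_iff) 
    have len: "length l = n" using distinct_card[OF l] set_l by simp
    define \<sigma> where "\<sigma> = (\<lambda>i. if i \<in> {1..n} then l ! (i - 1) else i)"
    have "map \<sigma> [1..<Suc n] = l"
      by (rule nth_equalityI) (simp_all add: len \<sigma>_def del: upt_Suc)
    then have w_perm: "w = perm_word n \<sigma>" by (simp add: w_eq perm_word_def)
    have "\<sigma> ` {1..n} = set (map \<sigma> [1..<Suc n])"
      by (simp add: atLeastLessThanSuc_atLeastAtMost del: upt_Suc)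
    also have "\<dots> = {1..n}" using \<open>map \<sigma> [1..<Suc n] = l\<close> set_l by simp
    finally have "\<sigma> ` {1..n} = {1..n}" .
    then have "\<sigma> permutes {1..n}"
      by (intro bij_imp_permutes) (auto simp: bij_betw_def finite_surj_inj \<sigma>_def intro: eq_card_imp_inj_on)
    then show "w \<in> perm_word n ` {\<sigma>. \<sigma> permutes {1..n}}" using w_perm by auto
  qed
qed

section \<open>Identification of the coefficients and conclusion\<close>

lemma A_poly_eq_motzkin:
  assumes "1 \<le> n"
  shows "A_poly n p q t u v w = motzkin p q (t * w) (u + v * t) n 2"
proof -
  have "A_poly n p q t u v w =
      (\<Sum>\<sigma> | \<sigma> permutes {1..n}. word_weight p q (t * w) u (v * t) (perm_word n \<sigma>))"
    unfolding A_poly_def word_weight_def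
    by (intro sum.cong refl)
       (simp add: local_weight_perm_word pat_31_2_eq pat_2_13_eq mult.assoc)
  also have "\<dots> = (\<Sum>w'\<in>words {1..n} 2. word_weight p q (t * w) u (v * t) w')"
    by (rule sum.reindex_bij_betw[OF bij_betw_perm_word[OF assms]])
  also have "\<dots> = motzkin p q (t * w) (u + v * t) n 2"
    by (subst sum_word_weight) simp_all
  finally show ?thesis .
qed

lemma const_poly_sum: "[:\<Sum>i\<in>A. f i:] = (\<Sum>i\<in>A. [:f i:])"
proof (induction A rule: infinite_finite_induct)
  case (insert a A)
  have "[:f a + sum f A:] = [:f a:] + [:sum f A:]" by simp
  then show ?case using insert by simp
qed simp_all

text \<open>Keeps \<open>p\<close> and \<open>q\<close> constant while an indeterminate is adjoined
  for comparing coefficients.\<close>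

lemma motzkin_coeff_const_poly:
  "motzkin_coeff [:p:] [:q:] n z k = [:motzkin_coeff p q n z k:]"
proof (induction n arbitrary: z k)
  case 0
  then show ?case by simp
next
  case (Suc n)
  have "pq_number [:p:] [:q:] m = [:pq_number p q m:]" for m
    by (simp add: pq_number_def const_poly_sum poly_const_pow mult.commute)
  then show ?case by (simp add: Suc)
qed

text \<open>Put \<open>t = u = 1\<close>, \<open>v = 0\<close> and let \<open>w\<close> be an
  indeterminate over the coefficient ring. Then \<open>u + v * t\<close> becomes 1, and the
  coefficient of its \<open>k\<close>-th power can be read off on both sides. The ring is arbitrary,
  so this covers both polynomial rings of the theorem.\<close>

lemma a_poly_eq_motzkin_coeff:
  assumes "1 \<le> n"
  shows "a_poly n k p q = motzkin_coeff p q n 2 k"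
proof -
  let ?X = "[:0, 1:] :: 'a poly"
  let ?f = "\<lambda>\<sigma>. p ^ pat_2_13 n \<sigma> * q ^ pat_31_2 n \<sigma>"
  have "A_poly n [:p:] [:q:] 1 1 0 ?X =
      (\<Sum>\<sigma> | \<sigma> permutes {1..n}. monom (if double_descents n \<sigma> = 0 then ?f \<sigma> else 0) (valley n \<sigma>))"
    \<comment> \<open>As \<open>0 ^ 0 = 1\<close>, setting \<open>v = 0\<close> keeps exactly the
      permutations without double descents.\<close>
    unfolding A_poly_def
    by (intro sum.cong refl) (simp add: poly_const_pow monom_altdef power_0_left mult.commute)
  then have "coeff (A_poly n [:p:] [:q:] 1 1 0 ?X) k =
      (\<Sum>\<sigma> | \<sigma> permutes {1..n}. if valley n \<sigma> = k \<and> double_descents n \<sigma> = 0 then ?f \<sigma> else 0)"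
    by (auto simp: coeff_sum intro!: sum.cong)
  also have "\<dots> = a_poly n k p q"
    unfolding a_poly_def S_set_def
    by (intro sum.mono_neutral_cong_right) (auto simp: finite_permutations)
  finally have "a_poly n k p q = coeff (A_poly n [:p:] [:q:] 1 1 0 ?X) k" ..
  also have "A_poly n [:p:] [:q:] 1 1 0 ?X = (\<Sum>j\<le>n. monom (motzkin_coeff p q n 2 j) j)"
    by (simp add: A_poly_eq_motzkin[OF assms] motzkin_eq_sum[of n n] motzkin_coeff_const_poly monom_altdef)
  also have "coeff \<dots> k = (if k \<le> n then motzkin_coeff p q n 2 k else 0)"
    by (simp add: coeff_sum)
  also have "\<dots> = motzkin_coeff p q n 2 k"
    by (simp add: motzkin_coeff_eq_0)
  finally show ?thesis .
qed

theorem theorem2: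
  fixes n :: nat
  assumes "n \<ge> 1"
  shows "A_poly n (Var P6) (Var Q6) (Var T6) (Var U6) (Var V6) (Var W6) =
           (\<Sum>k = 0..(n - 1) div 2.
              a_poly n k (Var P6) (Var Q6) * (Var T6 * Var W6) ^ k *
              (Var U6 + Var V6 * Var T6) ^ (n - 1 - 2 * k))
         \<and> (\<forall>k \<le> (n - 1) div 2. (Var P2 + Var Q2) ^ k dvd a_poly n k (Var P2) (Var Q2))"
proof (intro conjI allI impI)
  show "A_poly n (Var P6) (Var Q6) (Var T6) (Var U6) (Var V6) (Var W6) =
           (\<Sum>k = 0..(n - 1) div 2.
              a_poly n k (Var P6) (Var Q6) * (Var T6 * Var W6) ^ k *
              (Var U6 + Var V6 * Var T6) ^ (n - 1 - 2 * k))"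
    unfolding A_poly_eq_motzkin[OF assms] motzkin_eq_sum[OF order.refl] a_poly_eq_motzkin_coeff[OF assms]
    \<comment> \<open>The expansion runs over \<open>k \<le> n\<close>; beyond
      \<open>(n - 1) div 2\<close> we have \<open>n < 2 * k + 1\<close>, and the coefficients
      vanish.\<close>
    by (intro sum.mono_neutral_cong_right) (auto simp: motzkin_coeff_eq_0)
  show "(Var P2 + Var Q2) ^ k dvd a_poly n k (Var P2) (Var Q2)" for k
    \<comment> \<open>At the starting point \<open>z = 2\<close> the extra exponent
      \<open>(z - 1) div 2\<close> is 0.\<close>
    using power_dvd_motzkin_coeff[of "Var P2" "Var Q2" k 2 n]
    by (simp add: a_poly_eq_motzkin_coeff[OF assms])
qed

end
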